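(* Let $\mathbb{G}$ be a Carnot group of step two with Lie algebra $\mathfrak{g}=V_1\oplus V_2$, let $d=\dim V_1$ and $\mathfrak{h}=\dim V_2$, and fix an inner product on $\mathfrak{g}$ for which $V_1\perp V_2$. Let $e_1,\dots,e_d$ and $\varepsilon_1,\dots,\varepsilon_{\mathfrak h}$ be orthonormal bases of $V_1$ and $V_2$, $X_1,\dots,X_d$ and $Z_1,\dots,Z_{\mathfrak h}$ the corresponding left-invariant vector fields on $\mathbb{G}$, $\gamma_{ij}^m=\langle[e_i,e_j],\varepsilon_m\rangle$, $L=\sum_{i=1}^dX_i^2$, $\Gamma^Z(f)=\sum_{m=1}^{\mathfrak h}(Z_mf)^2$, and $$\rho_2=\inf_{\|z\|=1}\frac14\sum_{i,j=1}^d\Big(\sum_{m=1}^{\mathfrak h}\gamma_{ij}^mz_m\Big)^2,\qquad \kappa=\sup_{\|x\|=1}\sum_{j=1}^d\sum_{m=1}^{\mathfrak h}\Big(\sum_{i=1}^d\gamma_{ij}^mx_i\Big)^2,$$ where $z\in\mathbb{R}^{\mathfrak h}$, $x\in\mathbb{R}^d$. Then $\mathbb{G}$ satisfies the generalized curvature-dimension inequality $\mathrm{CD}(0,\rho_2,\kappa,d)$ with respect to $L$ and $\Gamma^Z$: for every $f\in C^\infty(\mathbb{G})$ and every $\nu>0$, $$\Gamma_2(f)+\nu\,\Gamma_2^Z(f)\ \ge\ \frac1d(Lf)^2-\frac\kappa\nu\,\Gamma(f)+\rho_2\,\Gamma^Z(f).$$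
   Context: A Carnot group of step two is the connected, simply connected Lie group $\mathbb{G}$ of a Lie algebra $\mathfrak{g}=V_1\oplus V_2$ with $[V_1,V_1]=V_2$ and $[V_1,V_2]=\{0\}$. $\Gamma(f,g)=\frac12(L(fg)-fLg-gLf)=\sum_i(X_if)(X_ig)$, $\Gamma^Z(f,g)=\sum_m(Z_mf)(Z_mg)$, $\Gamma(f)=\Gamma(f,f)$, $\Gamma^Z(f)=\Gamma^Z(f,f)$, $\Gamma_2(f)=\frac12[L\Gamma(f)-2\Gamma(f,Lf)]$, $\Gamma_2^Z(f)=\frac12[L\Gamma^Z(f)-2\Gamma^Z(f,Lf)]$. $\mathrm{CD}(\rho_1,\rho_2,\kappa,d)$ (with $\rho_1\in\mathbb{R}$, $\rho_2>0$, $\kappa\ge 0$, $0<d\le\infty$) means $\Gamma_2(f)+\nu\Gamma_2^Z(f)\ge\frac1d(Lf)^2+(\rho_1-\frac\kappa\nu)\Gamma(f)+\rho_2\Gamma^Z(f)$ for all smooth $f$ and $\nu>0$; in particular $\rho_2>0$ is part of the assertion. *)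

theory Defs
  imports "HOL-Analysis.Analysis"
begin

(* C^k and C^infinity on an open subset S of a Euclidean space; all derivatives are taken
   in the ambient space, so the notion is only meant for open S. *)
fun Ck_on :: "nat \<Rightarrow> 'e::euclidean_space set \<Rightarrow> ('e \<Rightarrow> 'f::euclidean_space) \<Rightarrow> bool" where
  "Ck_on 0 S f \<longleftrightarrow> continuous_on S f"
| "Ck_on (Suc k) S f \<longleftrightarrow>
     (\<forall>x\<in>S. f differentiable (at x)) \<and> (\<forall>v. Ck_on k S (\<lambda>x. frechet_derivative f (at x) v))"

definition smooth_on :: "'e::euclidean_space set \<Rightarrow> ('e \<Rightarrow> 'f::euclidean_space) \<Rightarrow> bool" where
  "smooth_on S f \<longleftrightarrow> (\<forall>k. Ck_on k S f)"

type_synonym ('g, 'e) chart = "'g set \<times> ('g \<Rightarrow> 'e)"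

(* The underlying space is the whole type 'g, which its type class makes Hausdorff and
   second countable. Atlases are not required to be maximal. *)
definition smooth_atlas ::
  "('g::{t2_space, second_countable_topology}, 'e::euclidean_space) chart set \<Rightarrow> bool" where
  "smooth_atlas A \<longleftrightarrow>
     (\<Union>(U, \<phi>)\<in>A. U) = UNIV \<and>
     (\<forall>(U, \<phi>)\<in>A. open U \<and> open (\<phi> ` U) \<and> homeomorphism U (\<phi> ` U) \<phi> (inv_into U \<phi>)) \<and>
     (\<forall>(U, \<phi>)\<in>A. \<forall>(W, \<psi>)\<in>A. smooth_on (\<phi> ` (U \<inter> W)) (\<psi> \<circ> inv_into U \<phi>))"

definition smooth_map ::
  "('g::topological_space, 'e::euclidean_space) chart set \<Rightarrow>
   ('h::topological_space, 'f::euclidean_space) chart set \<Rightarrow> ('g \<Rightarrow> 'h) \<Rightarrow> bool" where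
  "smooth_map A B F \<longleftrightarrow>
     continuous_on UNIV F \<and>
     (\<forall>(U, \<phi>)\<in>A. \<forall>(W, \<psi>)\<in>B. smooth_on (\<phi> ` (U \<inter> F -` W)) (\<psi> \<circ> F \<circ> inv_into U \<phi>))"

definition product_atlas ::
  "('g, 'e) chart set \<Rightarrow> ('h, 'f) chart set \<Rightarrow> ('g \<times> 'h, 'e \<times> 'f) chart set" where
  "product_atlas A B = {(U \<times> W, map_prod \<phi> \<psi>) |U \<phi> W \<psi>. (U, \<phi>) \<in> A \<and> (W, \<psi>) \<in> B}"

definition C_infinity ::
  "('g::topological_space, 'e::euclidean_space) chart set \<Rightarrow> ('g \<Rightarrow> real) set" where
  "C_infinity A = {f. smooth_map A {(UNIV, id)} f}"

definition lie_group ::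
  "('g::{t2_space, second_countable_topology}, 'e::euclidean_space) chart set \<Rightarrow>
   ('g \<Rightarrow> 'g \<Rightarrow> 'g) \<Rightarrow> 'g \<Rightarrow> ('g \<Rightarrow> 'g) \<Rightarrow> bool" where
  "lie_group A mul one ginv \<longleftrightarrow>
     smooth_atlas A \<and> group mul one ginv \<and>
     smooth_map (product_atlas A A) A (\<lambda>(g, h). mul g h) \<and> smooth_map A A ginv"

(* Tangent vectors at p are the derivations at p of C_infinity A. HOL functions being total,
   they are normalised to vanish on non-smooth functions, so that two tangent vectors are
   equal as soon as they agree on C_infinity A. *)
definition tangent_vector ::
  "('g::topological_space, 'e::euclidean_space) chart set \<Rightarrow> 'g \<Rightarrow> (('g \<Rightarrow> real) \<Rightarrow> real) \<Rightarrow> bool" where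
  "tangent_vector A p v \<longleftrightarrow>
     (\<forall>f\<in>C_infinity A. \<forall>g\<in>C_infinity A. v (\<lambda>q. f q + g q) = v f + v g) \<and>
     (\<forall>c. \<forall>f\<in>C_infinity A. v (\<lambda>q. c * f q) = c * v f) \<and>
     (\<forall>f\<in>C_infinity A. \<forall>g\<in>C_infinity A. v (\<lambda>q. f q * g q) = f p * v g + g p * v f) \<and>
     (\<forall>f. f \<notin> C_infinity A \<longrightarrow> v f = 0)"

type_synonym 'g vfield = "'g \<Rightarrow> ('g \<Rightarrow> real) \<Rightarrow> real"

definition vf_app :: "'g vfield \<Rightarrow> ('g \<Rightarrow> real) \<Rightarrow> 'g \<Rightarrow> real" where
  "vf_app X f = (\<lambda>p. X p f)"

definition smooth_vector_field ::
  "('g::topological_space, 'e::euclidean_space) chart set \<Rightarrow> 'g vfield \<Rightarrow> bool" where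
  "smooth_vector_field A X \<longleftrightarrow>
     (\<forall>p. tangent_vector A p (X p)) \<and> (\<forall>f\<in>C_infinity A. vf_app X f \<in> C_infinity A)"

(* The last conjunct says that the differential of the left translation by a
   maps X p to X (mul a p). *)
definition left_invariant_fields ::
  "('g::topological_space, 'e::euclidean_space) chart set \<Rightarrow> ('g \<Rightarrow> 'g \<Rightarrow> 'g) \<Rightarrow> 'g vfield set" where
  "left_invariant_fields A mul =
     {X. smooth_vector_field A X \<and>
         (\<forall>a p. \<forall>f\<in>C_infinity A. X p (\<lambda>q. f (mul a q)) = X (mul a p) f)}"

definition vf_bracket :: "'g vfield \<Rightarrow> 'g vfield \<Rightarrow> 'g vfield" where
  "vf_bracket X Y = (\<lambda>p f. X p (vf_app Y f) - Y p (vf_app X f))"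

definition lie_bracket :: "('a::real_vector \<Rightarrow> 'a \<Rightarrow> 'a) \<Rightarrow> bool" where
  "lie_bracket br \<longleftrightarrow>
     bilinear br \<and> (\<forall>x. br x x = 0) \<and>
     (\<forall>x y z. br x (br y z) + br y (br z x) + br z (br x y) = 0)"

(* \<Phi> identifies the Lie algebra ('a, br) with the Lie algebra of the group;
   \<Phi> x is the left-invariant vector field corresponding to x. *)
definition lie_algebra_iso ::
  "('g::topological_space, 'e::euclidean_space) chart set \<Rightarrow> ('g \<Rightarrow> 'g \<Rightarrow> 'g) \<Rightarrow>
   ('a::real_vector \<Rightarrow> 'a \<Rightarrow> 'a) \<Rightarrow> ('a \<Rightarrow> 'g vfield) \<Rightarrow> bool" where
  "lie_algebra_iso A mul br \<Phi> \<longleftrightarrow>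
     bij_betw \<Phi> UNIV (left_invariant_fields A mul) \<and>
     (\<forall>x y p f. \<Phi> (x + y) p f = \<Phi> x p f + \<Phi> y p f) \<and>
     (\<forall>c x p f. \<Phi> (c *\<^sub>R x) p f = c * \<Phi> x p f) \<and>
     (\<forall>x y. \<Phi> (br x y) = vf_bracket (\<Phi> x) (\<Phi> y))"

definition step_two_stratification ::
  "('a::real_vector \<Rightarrow> 'a \<Rightarrow> 'a) \<Rightarrow> 'a set \<Rightarrow> 'a set \<Rightarrow> bool" where
  "step_two_stratification br V1 V2 \<longleftrightarrow>
     subspace V1 \<and> subspace V2 \<and> V1 \<inter> V2 = {0} \<and> {x + y |x y. x \<in> V1 \<and> y \<in> V2} = UNIV \<and>
     span {br x y |x y. x \<in> V1 \<and> y \<in> V1} = V2 \<and>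
     (\<forall>x\<in>V1. \<forall>y\<in>V2. br x y = 0) \<and>
     V2 \<noteq> {0}"

definition carnot_group_step_two ::
  "('g::{t2_space, second_countable_topology}, 'e::euclidean_space) chart set \<Rightarrow>
   ('g \<Rightarrow> 'g \<Rightarrow> 'g) \<Rightarrow> 'g \<Rightarrow> ('g \<Rightarrow> 'g) \<Rightarrow>
   ('a::euclidean_space \<Rightarrow> 'a \<Rightarrow> 'a) \<Rightarrow> 'a set \<Rightarrow> 'a set \<Rightarrow> ('a \<Rightarrow> 'g vfield) \<Rightarrow> bool" where
  "carnot_group_step_two A mul one ginv br V1 V2 \<Phi> \<longleftrightarrow>
     lie_group A mul one ginv \<and>
     connected (UNIV :: 'g set) \<and> simply_connected (UNIV :: 'g set) \<and>
     lie_bracket br \<and> step_two_stratification br V1 V2 \<and>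
     lie_algebra_iso A mul br \<Phi>"

definition orthonormal_basis_of :: "'a::real_inner set \<Rightarrow> ('i \<Rightarrow> 'a) \<Rightarrow> bool" where
  "orthonormal_basis_of V b \<longleftrightarrow>
     (\<forall>i j. b i \<bullet> b j = (if i = j then 1 else 0)) \<and> span (range b) = V"

definition structure_const ::
  "('a::real_inner \<Rightarrow> 'a \<Rightarrow> 'a) \<Rightarrow> ('d \<Rightarrow> 'a) \<Rightarrow> ('h \<Rightarrow> 'a) \<Rightarrow> 'd \<Rightarrow> 'd \<Rightarrow> 'h \<Rightarrow> real" where
  "structure_const br e \<epsilon> i j m = br (e i) (e j) \<bullet> \<epsilon> m"

definition carnot_rho2 :: "('d::finite \<Rightarrow> 'd \<Rightarrow> 'h::finite \<Rightarrow> real) \<Rightarrow> real" where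
  "carnot_rho2 \<gamma> = (INF z\<in>{z :: real^'h. norm z = 1}.
     1/4 * (\<Sum>i\<in>UNIV. \<Sum>j\<in>UNIV. (\<Sum>m\<in>UNIV. \<gamma> i j m * z $ m)\<^sup>2))"

definition carnot_kappa :: "('d::finite \<Rightarrow> 'd \<Rightarrow> 'h::finite \<Rightarrow> real) \<Rightarrow> real" where
  "carnot_kappa \<gamma> = (SUP x\<in>{x :: real^'d. norm x = 1}.
     \<Sum>j\<in>UNIV. \<Sum>m\<in>UNIV. (\<Sum>i\<in>UNIV. \<gamma> i j m * x $ i)\<^sup>2)"

definition sum_of_squares_op :: "('i::finite \<Rightarrow> 'g vfield) \<Rightarrow> ('g \<Rightarrow> real) \<Rightarrow> 'g \<Rightarrow> real" where
  "sum_of_squares_op X f = (\<lambda>p. \<Sum>i\<in>UNIV. vf_app (X i) (vf_app (X i) f) p)"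

definition Gamma ::
  "(('g \<Rightarrow> real) \<Rightarrow> 'g \<Rightarrow> real) \<Rightarrow> ('g \<Rightarrow> real) \<Rightarrow> ('g \<Rightarrow> real) \<Rightarrow> 'g \<Rightarrow> real" where
  "Gamma L f g = (\<lambda>p. 1/2 * (L (\<lambda>q. f q * g q) p - f p * L g p - g p * L f p))"

definition GammaZ ::
  "('i::finite \<Rightarrow> 'g vfield) \<Rightarrow> ('g \<Rightarrow> real) \<Rightarrow> ('g \<Rightarrow> real) \<Rightarrow> 'g \<Rightarrow> real" where
  "GammaZ Z f g = (\<lambda>p. \<Sum>m\<in>UNIV. vf_app (Z m) f p * vf_app (Z m) g p)"

(* Iterated form of a bilinear form B along L: Gamma_2 for B = Gamma L,
   Gamma_2^Z for B = Gamma^Z. *)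
definition iterated_Gamma ::
  "(('g \<Rightarrow> real) \<Rightarrow> 'g \<Rightarrow> real) \<Rightarrow> (('g \<Rightarrow> real) \<Rightarrow> ('g \<Rightarrow> real) \<Rightarrow> 'g \<Rightarrow> real) \<Rightarrow>
   ('g \<Rightarrow> real) \<Rightarrow> 'g \<Rightarrow> real" where
  "iterated_Gamma L B f = (\<lambda>p. 1/2 * (L (B f f) p - 2 * B f (L f) p))"

(* d may be infinite, in which case real_of_ereal (1 / d) = 0. *)
definition CD ::
  "('g::topological_space, 'e::euclidean_space) chart set \<Rightarrow> (('g \<Rightarrow> real) \<Rightarrow> 'g \<Rightarrow> real) \<Rightarrow>
   (('g \<Rightarrow> real) \<Rightarrow> ('g \<Rightarrow> real) \<Rightarrow> 'g \<Rightarrow> real) \<Rightarrow> real \<Rightarrow> real \<Rightarrow> real \<Rightarrow> ereal \<Rightarrow> bool" where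
  "CD A L BZ \<rho>1 \<rho>2 \<kappa> d \<longleftrightarrow>
     \<rho>2 > 0 \<and> \<kappa> \<ge> 0 \<and> d > 0 \<and>
     (\<forall>f\<in>C_infinity A. \<forall>\<nu>>0. \<forall>p.
        iterated_Gamma L (Gamma L) f p + \<nu> * iterated_Gamma L BZ f p
          \<ge> real_of_ereal (1 / d) * (L f p)\<^sup>2 + (\<rho>1 - \<kappa> / \<nu>) * Gamma L f f p + \<rho>2 * BZ f f p)"

end

theory Submission
  imports Defs
begin

text \<open>
  Since \<open>[X\<^sub>i, X\<^sub>j] = \<Sum>\<^sub>m \<gamma>\<^sub>i\<^sub>j\<^sup>m Z\<^sub>m\<close> and the \<open>Z\<^sub>m\<close> commute with the \<open>X\<^sub>i\<close>, the
  Bochner formulas read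
  \<open>\<Gamma>\<^sub>2(f) = \<Sum>\<^sub>i\<^sub>j (X\<^sub>iX\<^sub>jf)\<^sup>2 + 2 \<Sum>\<^sub>i\<^sub>j\<^sub>m \<gamma>\<^sub>i\<^sub>j\<^sup>m (X\<^sub>jf) (X\<^sub>iZ\<^sub>mf)\<close> and
  \<open>\<Gamma>\<^sub>2\<^sup>Z(f) = \<Sum>\<^sub>i\<^sub>m (X\<^sub>iZ\<^sub>mf)\<^sup>2\<close>. The symmetric part of the horizontal Hessian \<open>X\<^sub>iX\<^sub>jf\<close>
  dominates \<open>(Lf)\<^sup>2/d\<close> by Cauchy--Schwarz on its diagonal, its antisymmetric part equals
  half the bracket and dominates \<open>\<rho>\<^sub>2 \<Gamma>\<^sup>Z(f)\<close>, and completing the square in \<open>X\<^sub>iZ\<^sub>mf\<close>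
  against the cross term costs \<open>(\<kappa>/\<nu>) \<Gamma>(f)\<close>. Positivity of \<open>\<rho>\<^sub>2\<close> holds because its infimum
  is attained and \<open>V\<^sub>2\<close> is spanned by the brackets \<open>[e\<^sub>i, e\<^sub>j]\<close>.
\<close>

subsection \<open>The algebra of smooth functions\<close>

text \<open>The Frechet derivative at a point depends only on values nearby, and openness of
  \<open>S\<close> turns agreement on \<open>S\<close> into local agreement. This allows
  \<open>frechet_derivative\<close> of a sum or product to be replaced by its explicit formula in
  the inductions below.\<close>

lemma Ck_on_cong:
  assumes "open S" "\<And>x. x \<in> S \<Longrightarrow> f x = g x" "Ck_on k S f"
  shows "Ck_on k S g"
  using assms(2,3)
proof (induction k arbitrary: f g)
  case 0
  then show ?case by (metis Ck_on.simps(1) continuous_on_cong)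
next
  case (Suc k)
  have der: "(g has_derivative frechet_derivative f (at x)) (at x)" if "x \<in> S" for x
  proof (rule has_derivative_transform_within_open[OF _ \<open>open S\<close> that])
    show "(f has_derivative frechet_derivative f (at x)) (at x)"
      using Suc.prems(2) that by (auto simp: frechet_derivative_works)
  qed (use Suc.prems(1) in auto)
  have "Ck_on k S (\<lambda>x. frechet_derivative g (at x) v)" for v
  proof (rule Suc.IH)
    show "Ck_on k S (\<lambda>x. frechet_derivative f (at x) v)"
      using Suc.prems(2) by simp
    show "frechet_derivative f (at x) v = frechet_derivative g (at x) v" if "x \<in> S" for x
      using frechet_derivative_at[OF der[OF that]] by simp
  qed
  then show ?case using der by (auto simp: differentiable_def)
qed

lemma Ck_on_lower: "Ck_on (Suc k) S f \<Longrightarrow> Ck_on k S f"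
proof (induction k arbitrary: f)
  case 0
  then show ?case
    by (auto intro!: continuous_at_imp_continuous_on differentiable_imp_continuous_within)
next
  case (Suc k)
  then show ?case by (metis Ck_on.simps(2))
qed

lemma Ck_on_const: "Ck_on k S (\<lambda>_. c)"
  by (induction k arbitrary: c) auto

lemma Ck_on_add:
  assumes "open S" "Ck_on k S f" "Ck_on k S g"
  shows "Ck_on k S (\<lambda>x. f x + g x)"
  using assms(2,3)
proof (induction k arbitrary: f g)
  case 0
  then show ?case by (simp add: continuous_on_add)
next
  case (Suc k)
  have der: "((\<lambda>x. f x + g x) has_derivative
      (\<lambda>v. frechet_derivative f (at x) v + frechet_derivative g (at x) v)) (at x)" if "x \<in> S" for x
    using Suc.prems that by (intro has_derivative_add) (auto simp: frechet_derivative_works)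
  have "Ck_on k S (\<lambda>x. frechet_derivative (\<lambda>x. f x + g x) (at x) v)" for v
  proof (rule Ck_on_cong[OF \<open>open S\<close>])
    show "Ck_on k S (\<lambda>x. frechet_derivative f (at x) v + frechet_derivative g (at x) v)"
      using Suc by simp
    show "frechet_derivative f (at x) v + frechet_derivative g (at x) v =
        frechet_derivative (\<lambda>x. f x + g x) (at x) v" if "x \<in> S" for x
      using fun_cong[OF frechet_derivative_at[OF der[OF that]]] by simp
  qed
  then show ?case using der by (auto simp: differentiable_def)
qed

lemma Ck_on_mult:
  fixes f g :: "'e::euclidean_space \<Rightarrow> real"
  assumes "open S" "Ck_on k S f" "Ck_on k S g"
  shows "Ck_on k S (\<lambda>x. f x * g x)"
  using assms(2,3)
proof (induction k arbitrary: f g)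
  case 0
  then show ?case by (simp add: continuous_on_mult)
next
  case (Suc k)
  have der: "((\<lambda>x. f x * g x) has_derivative
      (\<lambda>v. f x * frechet_derivative g (at x) v + frechet_derivative f (at x) v * g x)) (at x)"
    if "x \<in> S" for x
    using Suc.prems that by (intro has_derivative_mult) (auto simp: frechet_derivative_works)
  have "Ck_on k S (\<lambda>x. frechet_derivative (\<lambda>x. f x * g x) (at x) v)" for v
  proof (rule Ck_on_cong[OF \<open>open S\<close>])
    \<comment> \<open>The derivatives have order \<open>k\<close>, but the undifferentiated factors
      are given at order \<open>Suc k\<close>; \<open>Ck_on_lower\<close> brings these down so that
      the induction hypothesis covers both products.\<close>
    show "Ck_on k S (\<lambda>x. f x * frechet_derivative g (at x) v + frechet_derivative f (at x) v * g x)"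
      using Suc.prems Ck_on_lower[OF Suc.prems(1)] Ck_on_lower[OF Suc.prems(2)]
      by (intro Ck_on_add[OF \<open>open S\<close>] Suc.IH) auto
    show "f x * frechet_derivative g (at x) v + frechet_derivative f (at x) v * g x =
        frechet_derivative (\<lambda>x. f x * g x) (at x) v" if "x \<in> S" for x
      using fun_cong[OF frechet_derivative_at[OF der[OF that]]] by simp
  qed
  then show ?case using der by (auto simp: differentiable_def)
qed

lemma C_infinity_iff:
  "f \<in> C_infinity A \<longleftrightarrow> continuous_on UNIV f \<and>
     (\<forall>(U, \<phi>)\<in>A. smooth_on (\<phi> ` U) (\<lambda>x. f (inv_into U \<phi> x)))"
  by (simp add: C_infinity_def smooth_map_def comp_def)

lemma C_infinity_const: "(\<lambda>_. c) \<in> C_infinity A"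
  by (auto simp: C_infinity_iff smooth_on_def Ck_on_const)

lemma C_infinity_add:
  assumes "smooth_atlas A" "f \<in> C_infinity A" "g \<in> C_infinity A"
  shows "(\<lambda>q. f q + g q) \<in> C_infinity A"
  using assms
  by (fastforce simp: C_infinity_iff smooth_on_def smooth_atlas_def
      intro!: Ck_on_add continuous_on_add)

lemma C_infinity_mult:
  assumes "smooth_atlas A" "f \<in> C_infinity A" "g \<in> C_infinity A"
  shows "(\<lambda>q. f q * g q) \<in> C_infinity A"
  using assms
  by (fastforce simp: C_infinity_iff smooth_on_def smooth_atlas_def
      intro!: Ck_on_mult continuous_on_mult)

subsection \<open>Bochner formulas\<close>

text \<open>The algebraic content of a smooth vector field. The rules are restricted to the algebra
  \<open>C\<close> because tangent vectors obey them only on smooth functions, so closure of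
  \<open>C\<close> has to be carried along.\<close>

locale derivation =
  fixes C :: "('g \<Rightarrow> real) set" and D :: "('g \<Rightarrow> real) \<Rightarrow> 'g \<Rightarrow> real"
  assumes const_closed: "(\<lambda>_. c) \<in> C"
    and add_closed: "\<lbrakk>f \<in> C; g \<in> C\<rbrakk> \<Longrightarrow> (\<lambda>q. f q + g q) \<in> C"
    and mult_closed: "\<lbrakk>f \<in> C; g \<in> C\<rbrakk> \<Longrightarrow> (\<lambda>q. f q * g q) \<in> C"
    and closed: "f \<in> C \<Longrightarrow> D f \<in> C"
    and add: "\<lbrakk>f \<in> C; g \<in> C\<rbrakk> \<Longrightarrow> D (\<lambda>q. f q + g q) = (\<lambda>q. D f q + D g q)"
    and scale: "f \<in> C \<Longrightarrow> D (\<lambda>q. c * f q) = (\<lambda>q. c * D f q)"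
    and mult: "\<lbrakk>f \<in> C; g \<in> C\<rbrakk> \<Longrightarrow> D (\<lambda>q. f q * g q) = (\<lambda>q. f q * D g q + g q * D f q)"
begin

lemma zero: "D (\<lambda>_. 0) = (\<lambda>_. 0)"
  using scale[OF const_closed, of 0 0] by simp

lemma scale_closed: "f \<in> C \<Longrightarrow> (\<lambda>q. c * f q) \<in> C"
  by (intro mult_closed const_closed)

lemma sum_closed: "(\<And>i. i \<in> I \<Longrightarrow> f i \<in> C) \<Longrightarrow> (\<lambda>q. \<Sum>i\<in>I. f i q) \<in> C"
  by (induction I rule: infinite_finite_induct) (simp_all add: const_closed add_closed)

lemma sum: "(\<And>i. i \<in> I \<Longrightarrow> f i \<in> C) \<Longrightarrow> D (\<lambda>q. \<Sum>i\<in>I. f i q) = (\<lambda>q. \<Sum>i\<in>I. D (f i) q)"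
  by (induction I rule: infinite_finite_induct) (simp_all add: zero add sum_closed)

lemma second_mult:
  assumes "f \<in> C" "g \<in> C"
  shows "D (D (\<lambda>q. f q * g q)) = (\<lambda>q. f q * D (D g) q + 2 * D f q * D g q + g q * D (D f) q)"
  using assms by (simp add: mult add mult_closed closed algebra_simps fun_eq_iff)

end

text \<open>All that the Bochner computation needs from the group: \<open>bracket\<close> encodes
  [X_i, X_j] = sum_m \<gamma>_ij^m Z_m and \<open>commute\<close> encodes [X_i, Z_m] = 0.\<close>

locale step_two_frame =
  fixes C :: "('g \<Rightarrow> real) set" and X :: "'d::finite \<Rightarrow> 'g vfield" and Z :: "'h::finite \<Rightarrow> 'g vfield"
    and \<gamma> :: "'d \<Rightarrow> 'd \<Rightarrow> 'h \<Rightarrow> real"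
  assumes X: "derivation C (vf_app (X i))"
    and Z: "derivation C (vf_app (Z m))"
    and bracket: "f \<in> C \<Longrightarrow> vf_app (X i) (vf_app (X j) f) =
      (\<lambda>p. vf_app (X j) (vf_app (X i) f) p + (\<Sum>m\<in>UNIV. \<gamma> i j m * vf_app (Z m) f p))"
    and commute: "f \<in> C \<Longrightarrow> vf_app (X i) (vf_app (Z m) f) = vf_app (Z m) (vf_app (X i) f)"
begin

abbreviation "L \<equiv> sum_of_squares_op X"

lemmas X_closed = derivation.closed[OF X] and Z_closed = derivation.closed[OF Z]

text \<open>In the second-order Leibniz rule the terms with both derivatives on one factor cancel in
  \<open>Gamma\<close>, leaving only the mixed products.\<close>

lemma Gamma_eq:
  assumes "f \<in> C" "g \<in> C"
  shows "Gamma L f g = (\<lambda>p. \<Sum>i\<in>UNIV. vf_app (X i) f p * vf_app (X i) g p)"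
  using derivation.second_mult[OF X assms]
  by (simp add: fun_eq_iff Gamma_def sum_of_squares_op_def sum.distrib sum_distrib_left
      mult.assoc flip: sum_distrib_left)

lemma L_closed: "f \<in> C \<Longrightarrow> L f \<in> C"
  unfolding sum_of_squares_op_def by (intro derivation.sum_closed[OF X] X_closed)

text \<open>The identity L(g^2) = 2 g Lg + 2 \<Gamma>(g), summed over a family. With first
  derivatives of f as the family it gives the L-term of both iterated forms.\<close>

lemma L_sum_squares:
  assumes "\<And>j. j \<in> J \<Longrightarrow> g j \<in> C"
  shows "L (\<lambda>q. \<Sum>j\<in>J. g j q * g j q) p =
    2 * (\<Sum>j\<in>J. g j p * L (g j) p + (\<Sum>i\<in>UNIV. (vf_app (X i) (g j) p)\<^sup>2))"
proof -
  have "vf_app (X i) (vf_app (X i) (\<lambda>q. \<Sum>j\<in>J. g j q * g j q)) p =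
      (\<Sum>j\<in>J. 2 * (g j p * vf_app (X i) (vf_app (X i) (g j)) p + (vf_app (X i) (g j) p)\<^sup>2))" for i
  proof -
    interpret derivation C "vf_app (X i)" by (rule X)
    have "vf_app (X i) (vf_app (X i) (\<lambda>q. \<Sum>j\<in>J. g j q * g j q)) p =
        (\<Sum>j\<in>J. vf_app (X i) (vf_app (X i) (\<lambda>q. g j q * g j q)) p)"
      using assms by (subst sum, simp add: mult_closed, subst sum) (simp_all add: closed mult_closed)
    also have "\<dots> = (\<Sum>j\<in>J. 2 * (g j p * vf_app (X i) (vf_app (X i) (g j)) p
        + (vf_app (X i) (g j) p)\<^sup>2))"
      using assms by (intro sum.cong) (simp_all add: second_mult power2_eq_square)
    finally show ?thesis .
  qed
  then have "L (\<lambda>q. \<Sum>j\<in>J. g j q * g j q) p =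
      (\<Sum>j\<in>J. \<Sum>i\<in>UNIV. 2 * (g j p * vf_app (X i) (vf_app (X i) (g j)) p
        + (vf_app (X i) (g j) p)\<^sup>2))"
    unfolding sum_of_squares_op_def by (subst sum.swap) simp
  then show ?thesis
    by (simp add: sum_of_squares_op_def sum.distrib sum_distrib_left distrib_left)
qed

text \<open>One computation for both \<Gamma>_2 (\<open>Y = X\<close>) and \<Gamma>_2^Z
  (\<open>Y = Z\<close>): beyond the squares, what remains is \<open>Y j\<close> f times the
  commutator [X_i^2, Y_j] f.\<close>

lemma iterated_Gamma_sum:
  fixes Y :: "'k::finite \<Rightarrow> 'g vfield"
  assumes "f \<in> C" "\<And>j. derivation C (vf_app (Y j))"
    and B: "\<And>g. g \<in> C \<Longrightarrow> B f g = (\<lambda>p. \<Sum>j\<in>UNIV. vf_app (Y j) f p * vf_app (Y j) g p)"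
  shows "iterated_Gamma L B f p =
    (\<Sum>i\<in>UNIV. \<Sum>j\<in>UNIV. (vf_app (X i) (vf_app (Y j) f) p)\<^sup>2) +
    (\<Sum>i\<in>UNIV. \<Sum>j\<in>UNIV. vf_app (Y j) f p *
       (vf_app (X i) (vf_app (X i) (vf_app (Y j) f)) p - vf_app (Y j) (vf_app (X i) (vf_app (X i) f)) p))"
proof -
  have YL: "vf_app (Y j) (L f) = (\<lambda>p. \<Sum>i\<in>UNIV. vf_app (Y j) (vf_app (X i) (vf_app (X i) f)) p)" for j
    unfolding sum_of_squares_op_def using assms(1)
    by (intro derivation.sum[OF assms(2)] X_closed)
  have "iterated_Gamma L B f p =
     (\<Sum>j\<in>UNIV. vf_app (Y j) f p * L (vf_app (Y j) f) p
        + (\<Sum>i\<in>UNIV. (vf_app (X i) (vf_app (Y j) f) p)\<^sup>2))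
     - (\<Sum>j\<in>UNIV. vf_app (Y j) f p * vf_app (Y j) (L f) p)"
    using assms(1) derivation.closed[OF assms(2)]
    by (simp add: iterated_Gamma_def B L_closed L_sum_squares)
  also have "\<dots> = (\<Sum>j\<in>UNIV. \<Sum>i\<in>UNIV. (vf_app (X i) (vf_app (Y j) f) p)\<^sup>2) +
    (\<Sum>j\<in>UNIV. \<Sum>i\<in>UNIV. vf_app (Y j) f p *
       (vf_app (X i) (vf_app (X i) (vf_app (Y j) f)) p - vf_app (Y j) (vf_app (X i) (vf_app (X i) f)) p))"
    unfolding YL
    by (simp add: sum_of_squares_op_def sum.distrib sum_subtractf sum_distrib_left right_diff_distrib)
  finally show ?thesis
    by (subst (1 2) sum.swap)
qed

text \<open>The commutator [X_i^2, Z_m] vanishes, by \<open>commute\<close> at f and at X_i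
  f.\<close>

lemma iterated_GammaZ:
  assumes "f \<in> C"
  shows "iterated_Gamma L (GammaZ Z) f p = (\<Sum>i\<in>UNIV. \<Sum>m\<in>UNIV. (vf_app (X i) (vf_app (Z m) f) p)\<^sup>2)"
  using assms
  by (subst iterated_Gamma_sum[where Y = Z]) (simp_all add: Z GammaZ_def commute X_closed Z_closed)

text \<open>Moving X_j leftwards past the two factors X_i uses \<open>bracket\<close> first at f and
  then at X_i f. As Z_m commutes with X_i, both steps contribute the same sum, whence the factor
  2.\<close>

lemma iterated_Gamma_Gamma:
  assumes f: "f \<in> C"
  shows "iterated_Gamma L (Gamma L) f p =
    (\<Sum>i\<in>UNIV. \<Sum>j\<in>UNIV. (vf_app (X i) (vf_app (X j) f) p)\<^sup>2) +
    2 * (\<Sum>i\<in>UNIV. \<Sum>j\<in>UNIV. \<Sum>m\<in>UNIV.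
      \<gamma> i j m * vf_app (X j) f p * vf_app (X i) (vf_app (Z m) f) p)"
proof -
  have "vf_app (X i) (vf_app (X i) (vf_app (X j) f)) p - vf_app (X j) (vf_app (X i) (vf_app (X i) f)) p
      = 2 * (\<Sum>m\<in>UNIV. \<gamma> i j m * vf_app (X i) (vf_app (Z m) f) p)" for i j
  proof -
    interpret derivation C "vf_app (X i)" by (rule X)
    have "vf_app (X i) (vf_app (X i) (vf_app (X j) f)) p = vf_app (X i) (vf_app (X j) (vf_app (X i) f)) p
        + (\<Sum>m\<in>UNIV. \<gamma> i j m * vf_app (X i) (vf_app (Z m) f) p)"
      using f X_closed Z_closed by (simp add: bracket[of f i j] add sum sum_closed scale scale_closed)
    then show ?thesis
      using f by (simp add: bracket[of "vf_app (X i) f" i j] X_closed commute)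
  qed
  then show ?thesis
    using f by (subst iterated_Gamma_sum[where Y = X])
      (simp_all add: X Gamma_eq sum_distrib_left mult_ac)
qed

end

subsection \<open>The pointwise inequality\<close>

text \<open>The symmetric and antisymmetric parts of a matrix are orthogonal, so their squared norms
  add up. The factor 1/4 is the square of the 1/2 in (a_ij - a_ji)/2.\<close>

lemma sum_squares_ge_trace_antisym:
  fixes a :: "'d::finite \<Rightarrow> 'd \<Rightarrow> real"
  shows "(\<Sum>i\<in>UNIV. \<Sum>j\<in>UNIV. (a i j)\<^sup>2) \<ge>
    1 / real CARD('d) * (\<Sum>i\<in>UNIV. a i i)\<^sup>2 + 1/4 * (\<Sum>i\<in>UNIV. \<Sum>j\<in>UNIV. (a i j - a j i)\<^sup>2)"
proof -
  have "(\<Sum>i\<in>UNIV. a i i)\<^sup>2 \<le> (\<Sum>i\<in>UNIV. (a i i)\<^sup>2) * real CARD('d)"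
    by (rule sum_squared_le_sum_of_squares)
  then have "1 / real CARD('d) * (\<Sum>i\<in>UNIV. a i i)\<^sup>2 \<le> (\<Sum>i\<in>UNIV. (a i i)\<^sup>2)"
    by (simp add: divide_le_eq)
  \<comment> \<open>Writing the diagonal as a sum over \<open>{i}\<close> makes it a subsum of the
    full symmetric part, so \<open>sum_mono2\<close> applies.\<close>
  also have "\<dots> = (\<Sum>i\<in>UNIV. \<Sum>j\<in>{i}. ((a i j + a j i) / 2)\<^sup>2)"
    by simp
  also have "\<dots> \<le> (\<Sum>i\<in>UNIV. \<Sum>j\<in>UNIV. ((a i j + a j i) / 2)\<^sup>2)"
    by (intro sum_mono sum_mono2) auto
  finally have diag: "1 / real CARD('d) * (\<Sum>i\<in>UNIV. a i i)\<^sup>2 \<le>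
    (\<Sum>i\<in>UNIV. \<Sum>j\<in>UNIV. ((a i j + a j i) / 2)\<^sup>2)" .
  have swap: "(\<Sum>i\<in>UNIV. \<Sum>j\<in>UNIV. (a j i)\<^sup>2) = (\<Sum>i\<in>UNIV. \<Sum>j\<in>UNIV. (a i j)\<^sup>2)"
    by (rule sum.swap)
  have "(\<Sum>i\<in>UNIV. \<Sum>j\<in>UNIV. ((a i j + a j i) / 2)\<^sup>2) + 1/4 * (\<Sum>i\<in>UNIV. \<Sum>j\<in>UNIV. (a i j - a j i)\<^sup>2)
      = (\<Sum>i\<in>UNIV. \<Sum>j\<in>UNIV. 1/2 * (a i j)\<^sup>2 + 1/2 * (a j i)\<^sup>2)"
    unfolding sum_distrib_left sum.distrib[symmetric]
    by (intro sum.cong) (auto simp: power2_eq_square field_simps)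
  also have "\<dots> = (\<Sum>i\<in>UNIV. \<Sum>j\<in>UNIV. (a i j)\<^sup>2)"
    using swap by (simp add: sum.distrib flip: sum_divide_distrib)
  finally show ?thesis using diag by linarith
qed

text \<open>Normalising \<open>y\<close> transfers bounds from the unit sphere, where
  \<open>carnot_rho2\<close> and \<open>carnot_kappa\<close> are defined, to all vectors.\<close>

lemma quadratic_form_sphere_scaling:
  fixes q :: "real^'n \<Rightarrow> real"
  assumes hom: "\<And>c y. q (c *\<^sub>R y) = c\<^sup>2 * q y"
  shows "\<exists>u. norm u = 1 \<and> q y = (norm y)\<^sup>2 * q u"
proof (cases "y = 0")
  case True
  obtain u :: "real^'n" where "norm u = 1"
    using vector_choose_size[of 1] by auto
  \<comment> \<open>Homogeneity with scalar 0 forces \<open>q 0 = 0\<close>, so any unit vector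
    serves.\<close>
  with True hom[of 0 0] show ?thesis by auto
next
  case False
  then show ?thesis
    using hom[of "norm y" "y /\<^sub>R norm y"] by (intro exI[of _ "y /\<^sub>R norm y"]) simp
qed

lemma norm_vec_lambda_squared: "(norm (\<chi> i. z i :: real^'n))\<^sup>2 = (\<Sum>i\<in>UNIV. (z i)\<^sup>2)"
  by (simp add: norm_vec_def L2_set_def sum_nonneg)

lemma carnot_rho2_le:
  fixes \<gamma> :: "'d::finite \<Rightarrow> 'd \<Rightarrow> 'h::finite \<Rightarrow> real"
  shows "carnot_rho2 \<gamma> * (\<Sum>m\<in>UNIV. (z m)\<^sup>2) \<le>
    1/4 * (\<Sum>i\<in>UNIV. \<Sum>j\<in>UNIV. (\<Sum>m\<in>UNIV. \<gamma> i j m * z m)\<^sup>2)"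
proof -
  define q where "q y = 1/4 * (\<Sum>i\<in>UNIV. \<Sum>j\<in>UNIV. (\<Sum>m\<in>UNIV. \<gamma> i j m * y $ m)\<^sup>2)" for y :: "real^'h"
  have "q (c *\<^sub>R y) = c\<^sup>2 * q y" for c y
  proof -
    have scaled: "(\<Sum>m\<in>UNIV. \<gamma> i j m * (c *\<^sub>R y) $ m) = c * (\<Sum>m\<in>UNIV. \<gamma> i j m * y $ m)" for i j
      by (simp add: sum_distrib_left mult_ac)
    show ?thesis
      unfolding q_def scaled power_mult_distrib by (simp only: sum_distrib_left mult.left_commute)
  qed
  then obtain u where u: "norm u = 1" "q (\<chi> m. z m) = (norm (\<chi> m. z m))\<^sup>2 * q u"
    using quadratic_form_sphere_scaling by metis
  \<comment> \<open>A real \<open>INF\<close> is a lower bound only for a family bounded below; here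
    0 bounds the sums of squares.\<close>
  have "carnot_rho2 \<gamma> \<le> q u"
    unfolding carnot_rho2_def q_def using u(1)
    by (intro cINF_lower bdd_belowI2[of _ 0]) (auto intro!: sum_nonneg mult_nonneg_nonneg)
  then have "carnot_rho2 \<gamma> * (\<Sum>m\<in>UNIV. (z m)\<^sup>2) \<le> q (\<chi> m. z m)"
    unfolding u(2) norm_vec_lambda_squared
    by (subst mult.commute) (intro mult_left_mono sum_nonneg, auto)
  then show ?thesis by (simp add: q_def)
qed

text \<open>A continuous function is bounded on the compact sphere; without a bound the real
  \<open>SUP\<close> would give no estimate.\<close>

lemma bdd_above_carnot_kappa:
  fixes \<gamma> :: "'d::finite \<Rightarrow> 'd \<Rightarrow> 'h::finite \<Rightarrow> real"
  shows "bdd_above ((\<lambda>x::real^'d. \<Sum>j\<in>UNIV. \<Sum>m\<in>UNIV. (\<Sum>i\<in>UNIV. \<gamma> i j m * x $ i)\<^sup>2) ` {x. norm x = 1})"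
proof -
  have "compact {x::real^'d. norm x = 1}"
    using compact_sphere[of "0::real^'d" 1] by (simp add: sphere_def dist_norm)
  then have "compact ((\<lambda>x::real^'d. \<Sum>j\<in>UNIV. \<Sum>m\<in>UNIV. (\<Sum>i\<in>UNIV. \<gamma> i j m * x $ i)\<^sup>2) ` {x. norm x = 1})"
    by (intro compact_continuous_image continuous_intros)
  then show ?thesis by (intro bounded_imp_bdd_above compact_imp_bounded)
qed

lemma carnot_kappa_ge:
  fixes \<gamma> :: "'d::finite \<Rightarrow> 'd \<Rightarrow> 'h::finite \<Rightarrow> real"
  shows "(\<Sum>j\<in>UNIV. \<Sum>m\<in>UNIV. (\<Sum>i\<in>UNIV. \<gamma> i j m * x i)\<^sup>2) \<le> carnot_kappa \<gamma> * (\<Sum>i\<in>UNIV. (x i)\<^sup>2)"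
proof -
  define q where "q y = (\<Sum>j\<in>UNIV. \<Sum>m\<in>UNIV. (\<Sum>i\<in>UNIV. \<gamma> i j m * y $ i)\<^sup>2)" for y :: "real^'d"
  have "q (c *\<^sub>R y) = c\<^sup>2 * q y" for c y
  proof -
    have scaled: "(\<Sum>i\<in>UNIV. \<gamma> i j m * (c *\<^sub>R y) $ i) = c * (\<Sum>i\<in>UNIV. \<gamma> i j m * y $ i)" for j m
      by (simp add: sum_distrib_left mult_ac)
    show ?thesis
      unfolding q_def scaled power_mult_distrib by (simp only: sum_distrib_left mult.left_commute)
  qed
  then obtain u where u: "norm u = 1" "q (\<chi> i. x i) = (norm (\<chi> i. x i))\<^sup>2 * q u"
    using quadratic_form_sphere_scaling by metis
  have "q u \<le> carnot_kappa \<gamma>"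
    unfolding carnot_kappa_def q_def using u(1)
    by (intro cSUP_upper bdd_above_carnot_kappa) auto
  then have "q (\<chi> i. x i) \<le> carnot_kappa \<gamma> * (\<Sum>i\<in>UNIV. (x i)\<^sup>2)"
    unfolding u(2) norm_vec_lambda_squared
    by (subst (2) mult.commute) (intro mult_left_mono sum_nonneg, auto)
  then show ?thesis by (simp add: q_def)
qed

lemma carnot_kappa_nonneg: "carnot_kappa \<gamma> \<ge> 0"
proof -
  have "(\<Sum>j\<in>UNIV. \<Sum>m\<in>UNIV. (\<Sum>i\<in>UNIV. \<gamma> i j m * (if i = k then 1 else 0))\<^sup>2) \<le> carnot_kappa \<gamma>" for k
  proof -
    \<comment> \<open>The test vector is the \<open>k\<close>-th standard unit vector, so its
      squared norm is 1.\<close>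
    have "(if i = k then 1 else 0)\<^sup>2 = (if i = k then 1 else 0 :: real)" for i
      by simp
    then show ?thesis
      using carnot_kappa_ge[of \<gamma> "\<lambda>i. if i = k then 1 else 0"] by simp
  qed
  then show ?thesis
    by (rule order_trans[rotated]) (auto intro!: sum_nonneg)
qed

lemma (in step_two_frame) curvature_dimension:
  assumes f: "f \<in> C" and "\<nu> > 0" and antisym: "\<And>i j m. \<gamma> j i m = - \<gamma> i j m"
  shows "iterated_Gamma L (Gamma L) f p + \<nu> * iterated_Gamma L (GammaZ Z) f p \<ge>
    1 / real CARD('d) * (L f p)\<^sup>2 - carnot_kappa \<gamma> / \<nu> * Gamma L f f p + carnot_rho2 \<gamma> * GammaZ Z f f p"
proof -
  define a where "a i j = vf_app (X i) (vf_app (X j) f) p" for i j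
  define x where "x j = vf_app (X j) f p" for j
  define z where "z m = vf_app (Z m) f p" for m
  define w where "w i m = vf_app (X i) (vf_app (Z m) f) p" for i m
  \<comment> \<open>Contracting \<open>\<gamma>\<close> with \<open>x\<close> turns the triple cross
    sum into the pairing of \<open>b\<close> with \<open>w\<close>, ready for completing the
    square.\<close>
  define b where "b i m = (\<Sum>j\<in>UNIV. \<gamma> i j m * x j)" for i m
  have "a i j - a j i = (\<Sum>m\<in>UNIV. \<gamma> i j m * z m)" for i j
    unfolding a_def z_def using fun_cong[OF bracket[OF f, of i j], of p] by simp
  then have hess: "1 / real CARD('d) * (\<Sum>i\<in>UNIV. a i i)\<^sup>2 + carnot_rho2 \<gamma> * (\<Sum>m\<in>UNIV. (z m)\<^sup>2)
      \<le> (\<Sum>i\<in>UNIV. \<Sum>j\<in>UNIV. (a i j)\<^sup>2)"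
    using sum_squares_ge_trace_antisym[of a] carnot_rho2_le[of \<gamma> z] by simp
  \<comment> \<open>\<open>b\<close> contracts \<open>x\<close> with the second index of
    \<open>\<gamma>\<close>, \<open>carnot_kappa\<close> with the first; antisymmetry exchanges them
    and the square removes the sign.\<close>
  have "(b i m)\<^sup>2 = (\<Sum>j\<in>UNIV. \<gamma> j i m * x j)\<^sup>2" for i m
    unfolding b_def by (subst antisym) (simp add: sum_negf)
  then have "(\<Sum>i\<in>UNIV. \<Sum>m\<in>UNIV. (b i m)\<^sup>2) \<le> carnot_kappa \<gamma> * (\<Sum>j\<in>UNIV. (x j)\<^sup>2)"
    using carnot_kappa_ge[of \<gamma> x] by simp
  then have "- (carnot_kappa \<gamma> / \<nu> * (\<Sum>j\<in>UNIV. (x j)\<^sup>2)) \<le> (\<Sum>i\<in>UNIV. \<Sum>m\<in>UNIV. - ((b i m)\<^sup>2 / \<nu>))"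
    using \<open>\<nu> > 0\<close> by (simp add: sum_negf divide_right_mono flip: sum_divide_distrib)
  also have "\<dots> \<le> (\<Sum>i\<in>UNIV. \<Sum>m\<in>UNIV. 2 * (b i m * w i m) + \<nu> * (w i m)\<^sup>2)"
  proof (intro sum_mono)
    fix i m
    \<comment> \<open>Completing the square with weight \<nu> is what produces the term
      \<kappa>/\<nu>.\<close>
    have "0 \<le> (b i m + \<nu> * w i m)\<^sup>2 / \<nu>" using \<open>\<nu> > 0\<close> by simp
    also have "\<dots> = (b i m)\<^sup>2 / \<nu> + (2 * (b i m * w i m) + \<nu> * (w i m)\<^sup>2)"
      using \<open>\<nu> > 0\<close> by (simp add: field_simps power2_eq_square)
    finally show "- ((b i m)\<^sup>2 / \<nu>) \<le> 2 * (b i m * w i m) + \<nu> * (w i m)\<^sup>2" by simp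
  qed
  also have "\<dots> = 2 * (\<Sum>i\<in>UNIV. \<Sum>m\<in>UNIV. b i m * w i m) + \<nu> * (\<Sum>i\<in>UNIV. \<Sum>m\<in>UNIV. (w i m)\<^sup>2)"
    by (simp add: sum.distrib sum_distrib_left)
  also have "(\<Sum>i\<in>UNIV. \<Sum>m\<in>UNIV. b i m * w i m) =
      (\<Sum>i\<in>UNIV. \<Sum>j\<in>UNIV. \<Sum>m\<in>UNIV. \<gamma> i j m * x j * w i m)"
    unfolding b_def sum_distrib_right by (intro sum.cong refl sum.swap)
  finally have cross: "- (carnot_kappa \<gamma> / \<nu> * (\<Sum>j\<in>UNIV. (x j)\<^sup>2)) \<le>
      2 * (\<Sum>i\<in>UNIV. \<Sum>j\<in>UNIV. \<Sum>m\<in>UNIV. \<gamma> i j m * x j * w i m) + \<nu> * (\<Sum>i\<in>UNIV. \<Sum>m\<in>UNIV. (w i m)\<^sup>2)" .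
  have "Gamma L f f p = (\<Sum>j\<in>UNIV. (x j)\<^sup>2)" "GammaZ Z f f p = (\<Sum>m\<in>UNIV. (z m)\<^sup>2)"
    "L f p = (\<Sum>i\<in>UNIV. a i i)"
    using f by (simp_all add: Gamma_eq GammaZ_def sum_of_squares_op_def x_def z_def a_def power2_eq_square)
  then show ?thesis
    using hess cross f
    unfolding iterated_Gamma_Gamma[OF f] iterated_GammaZ[OF f] a_def x_def z_def w_def by simp
qed

subsection \<open>Carnot groups of step two\<close>

text \<open>Both sides are linear in \<open>x\<close> and agree on the basis vectors, so induction
  over the span suffices.\<close>

lemma orthonormal_basis_expansion:
  fixes b :: "'i::finite \<Rightarrow> 'a::real_inner"
  assumes "orthonormal_basis_of V b" "x \<in> V"
  shows "x = (\<Sum>i\<in>UNIV. (x \<bullet> b i) *\<^sub>R b i)"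
proof -
  have "x \<in> span (range b)" using assms by (simp add: orthonormal_basis_of_def)
  then show ?thesis
  proof (induction rule: span_induct_alt)
    case (step c v y)
    then obtain k where "v = b k" by auto
    moreover have "(\<Sum>i\<in>UNIV. (b k \<bullet> b i) *\<^sub>R b i) = b k"
      using assms(1) by (simp add: orthonormal_basis_of_def if_distrib[of "\<lambda>c. c *\<^sub>R _"] cong: if_cong)
    moreover have "(\<Sum>i\<in>UNIV. ((c *\<^sub>R b k + y) \<bullet> b i) *\<^sub>R b i) =
        c *\<^sub>R (\<Sum>i\<in>UNIV. (b k \<bullet> b i) *\<^sub>R b i) + (\<Sum>i\<in>UNIV. (y \<bullet> b i) *\<^sub>R b i)"
      by (simp add: inner_add_left scaleR_add_left sum.distrib scaleR_sum_right)
    ultimately show ?case using step by simp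
  qed simp
qed

text \<open>Bridges the dimension in the theorem, \<open>dim V1\<close>, and the one in the
  estimates, the size of the index type.\<close>

lemma orthonormal_basis_dim:
  fixes b :: "'i::finite \<Rightarrow> 'a::euclidean_space"
  assumes "orthonormal_basis_of V b"
  shows "dim V = CARD('i)"
proof -
  have on: "b i \<bullet> b j = (if i = j then 1 else 0)" for i j
    using assms by (simp add: orthonormal_basis_of_def)
  have "inj b"
    by (rule injI) (metis on zero_neq_one)
  moreover have "independent (range b)"
  proof (rule pairwise_orthogonal_independent)
    show "pairwise orthogonal (range b)"
      using on by (auto simp: pairwise_def orthogonal_def)
    show "0 \<notin> range b"
      using on by (metis imageE inner_zero_left zero_neq_one)
  qed
  ultimately show ?thesis
    using assms by (metis card_image dim_eq_card_independent dim_span orthonormal_basis_of_def)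
qed

text \<open>The infimum is a minimum by compactness of the sphere, so it suffices that the form is
  positive at each unit vector.\<close>

lemma carnot_rho2_pos:
  fixes e :: "'d::finite \<Rightarrow> 'a::euclidean_space" and \<epsilon> :: "'h::finite \<Rightarrow> 'a"
  assumes br: "bilinear br" and V2: "span {br x y |x y. x \<in> V1 \<and> y \<in> V1} = V2"
    and e: "orthonormal_basis_of V1 e" and \<epsilon>: "orthonormal_basis_of V2 \<epsilon>"
  shows "carnot_rho2 (structure_const br e \<epsilon>) > 0"
proof -
  define \<gamma> where "\<gamma> = structure_const br e \<epsilon>"
  define q where "q z = 1/4 * (\<Sum>i\<in>UNIV. \<Sum>j\<in>UNIV. (\<Sum>m\<in>UNIV. \<gamma> i j m * z $ m)\<^sup>2)" for z :: "real^'h"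
  have q_nonneg: "q z \<ge> 0" for z
    unfolding q_def by (intro mult_nonneg_nonneg sum_nonneg) auto
  have q_pos: "q z > 0" if "norm z = 1" for z
  proof (rule ccontr)
    assume "\<not> q z > 0"
    then have "(\<Sum>i\<in>UNIV. \<Sum>j\<in>UNIV. (\<Sum>m\<in>UNIV. \<gamma> i j m * z $ m)\<^sup>2) = 0"
      using q_nonneg[of z] by (simp add: q_def)
    then have \<gamma>0: "(\<Sum>m\<in>UNIV. \<gamma> i j m * z $ m) = 0" for i j
      by (simp add: sum_nonneg_eq_0_iff sum_nonneg)
    \<comment> \<open>A zero \<open>z\<close> of the form yields an element of \<open>V2\<close>
      orthogonal to all brackets of \<open>V1\<close>, hence to their span \<open>V2\<close>; its
      coordinates \<open>z\<close> then vanish, contradicting \<open>norm z = 1\<close>.\<close>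
    define v where "v = (\<Sum>m\<in>UNIV. z $ m *\<^sub>R \<epsilon> m)"
    have "br (e i) (e j) \<bullet> v = 0" for i j
      using \<gamma>0[of i j] by (simp add: v_def inner_sum_right \<gamma>_def structure_const_def mult.commute)
    then have "br x y \<bullet> v = 0" if "x \<in> V1" "y \<in> V1" for x y
      by (subst orthonormal_basis_expansion[OF e that(1)], subst orthonormal_basis_expansion[OF e that(2)])
        (simp add: bilinear_sum[OF br] bilinear_lmul[OF br] bilinear_rmul[OF br] inner_sum_left
          case_prod_unfold)
    then have "{br x y |x y. x \<in> V1 \<and> y \<in> V1} \<subseteq> {u. v \<bullet> u = 0}"
      by (auto simp: inner_commute)
    then have "V2 \<subseteq> {u. v \<bullet> u = 0}"
      unfolding V2[symmetric] by (rule span_minimal) (rule subspace_hyperplane)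
    then have "u \<bullet> v = 0" if "u \<in> V2" for u
      using that by (auto simp: inner_commute)
    moreover have "\<epsilon> m \<in> V2" for m
      using \<epsilon> by (auto simp: orthonormal_basis_of_def intro: span_base)
    ultimately have "\<epsilon> m \<bullet> v = 0" for m by blast
    moreover have "\<epsilon> m \<bullet> v = z $ m" for m
    proof -
      have "\<epsilon> m \<bullet> \<epsilon> k = (if m = k then 1 else 0)" for k
        using \<epsilon> by (simp add: orthonormal_basis_of_def)
      then show ?thesis
        by (simp add: v_def inner_sum_right if_distrib[of "\<lambda>c. _ * c"] cong: if_cong)
    qed
    ultimately have "z = 0" by (simp add: vec_eq_iff)
    with that show False by simp
  qed
  have "compact {z::real^'h. norm z = 1}"
    using compact_sphere[of "0::real^'h" 1] by (simp add: sphere_def dist_norm)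
  moreover have "{z::real^'h. norm z = 1} \<noteq> {}"
    using vector_choose_size[of 1] by auto
  moreover have "continuous_on {z. norm z = 1} q"
    unfolding q_def by (intro continuous_intros)
  ultimately obtain z0 where z0: "norm z0 = 1" "\<And>z. norm z = 1 \<Longrightarrow> q z0 \<le> q z"
    using continuous_attains_inf[of "{z. norm z = 1}" q] by auto
  have "q z0 \<le> carnot_rho2 \<gamma>"
    unfolding carnot_rho2_def q_def[symmetric] using z0 by (intro cINF_greatest) auto
  with q_pos[OF z0(1)] show ?thesis by (simp add: \<gamma>_def)
qed

text \<open>The derivation laws at each point assemble into those of an operator; the atlas supplies
  open chart images, on which sums and products stay smooth.\<close>

lemma left_invariant_derivation:
  assumes "smooth_atlas A" "X \<in> left_invariant_fields A mul"
  shows "derivation (C_infinity A) (vf_app X)"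
  using assms
  by unfold_locales
    (auto simp: left_invariant_fields_def smooth_vector_field_def tangent_vector_def vf_app_def
      C_infinity_const C_infinity_add C_infinity_mult)

text \<open>\<open>bracket\<close> comes from expanding [e_i, e_j], which lies in \<open>V2\<close>,
  in the basis \<open>\<epsilon>\<close>, and \<open>commute\<close> from [V1, V2] = 0;
  \<open>\<Phi>\<close> carries both to vector fields.\<close>

lemma carnot_frame:
  fixes e :: "'d::finite \<Rightarrow> 'a::euclidean_space" and \<epsilon> :: "'h::finite \<Rightarrow> 'a"
  assumes G: "carnot_group_step_two A mul one ginv br V1 V2 \<Phi>"
    and e: "orthonormal_basis_of V1 e" and \<epsilon>: "orthonormal_basis_of V2 \<epsilon>"
  shows "step_two_frame (C_infinity A) (\<lambda>i. \<Phi> (e i)) (\<lambda>m. \<Phi> (\<epsilon> m)) (structure_const br e \<epsilon>)"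
proof (rule step_two_frame.intro)
  have atlas: "smooth_atlas A" and iso: "lie_algebra_iso A mul br \<Phi>"
    and strat: "step_two_stratification br V1 V2"
    using G by (auto simp: carnot_group_step_two_def lie_group_def)
  have \<Phi>_in: "\<Phi> x \<in> left_invariant_fields A mul" for x
    using iso by (auto simp: lie_algebra_iso_def bij_betw_def)
  show "derivation (C_infinity A) (vf_app (\<Phi> (e i)))" for i
    by (rule left_invariant_derivation[OF atlas \<Phi>_in])
  show "derivation (C_infinity A) (vf_app (\<Phi> (\<epsilon> m)))" for m
    by (rule left_invariant_derivation[OF atlas \<Phi>_in])
  have \<Phi>_add: "\<Phi> (x + y) p f = \<Phi> x p f + \<Phi> y p f"
    and \<Phi>_scale: "\<Phi> (c *\<^sub>R x) p f = c * \<Phi> x p f"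
    and \<Phi>_br: "\<Phi> (br x y) p f = \<Phi> x p (vf_app (\<Phi> y) f) - \<Phi> y p (vf_app (\<Phi> x) f)" for x y c p f
    using iso by (auto simp: lie_algebra_iso_def vf_bracket_def)
  have \<Phi>_0: "\<Phi> 0 p f = 0" for p f
    using \<Phi>_scale[of 0 0 p f] by simp
  have \<Phi>_sum: "\<Phi> (\<Sum>m\<in>I. y m) p f = (\<Sum>m\<in>I. \<Phi> (y m) p f)" if "finite I" for I :: "'h set" and y p f
    using that by (induction I) (auto simp: \<Phi>_0 \<Phi>_add)
  have e_in: "e i \<in> V1" and \<epsilon>_in: "\<epsilon> m \<in> V2" for i m
    using e \<epsilon> by (auto simp: orthonormal_basis_of_def intro: span_base)
  show "vf_app (\<Phi> (e i)) (vf_app (\<Phi> (\<epsilon> m)) f) = vf_app (\<Phi> (\<epsilon> m)) (vf_app (\<Phi> (e i)) f)" for i m f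
  proof
    fix p
    have "br (e i) (\<epsilon> m) = 0"
      using strat e_in \<epsilon>_in by (auto simp: step_two_stratification_def)
    then show "vf_app (\<Phi> (e i)) (vf_app (\<Phi> (\<epsilon> m)) f) p = vf_app (\<Phi> (\<epsilon> m)) (vf_app (\<Phi> (e i)) f) p"
      using \<Phi>_br[of "e i" "\<epsilon> m" p f] by (simp add: vf_app_def \<Phi>_0)
  qed
  show "vf_app (\<Phi> (e i)) (vf_app (\<Phi> (e j)) f) = (\<lambda>p. vf_app (\<Phi> (e j)) (vf_app (\<Phi> (e i)) f) p +
      (\<Sum>m\<in>UNIV. structure_const br e \<epsilon> i j m * vf_app (\<Phi> (\<epsilon> m)) f p))" for i j f
  proof
    fix p
    have "br (e i) (e j) \<in> span {br x y |x y. x \<in> V1 \<and> y \<in> V1}"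
      using e_in by (intro span_base) blast
    then have "br (e i) (e j) \<in> V2"
      using strat by (simp add: step_two_stratification_def)
    then have "\<Phi> (br (e i) (e j)) p f =
        \<Phi> (\<Sum>m\<in>UNIV. structure_const br e \<epsilon> i j m *\<^sub>R \<epsilon> m) p f"
      unfolding structure_const_def using orthonormal_basis_expansion[OF \<epsilon>] by metis
    then show "vf_app (\<Phi> (e i)) (vf_app (\<Phi> (e j)) f) p = vf_app (\<Phi> (e j)) (vf_app (\<Phi> (e i)) f) p +
      (\<Sum>m\<in>UNIV. structure_const br e \<epsilon> i j m * vf_app (\<Phi> (\<epsilon> m)) f p)"
      using \<Phi>_br[of "e i" "e j" p f] by (simp add: vf_app_def \<Phi>_sum \<Phi>_scale)
  qed
qed

text \<open>Polarisation: expand the vanishing bracket of \<open>x + y\<close> with itself.\<close>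

lemma lie_bracket_antisym:
  assumes "lie_bracket br"
  shows "br y x = - br x y"
proof -
  have br: "bilinear br" and alt: "br x x = 0" for x
    using assms by (auto simp: lie_bracket_def)
  have "br (x + y) (x + y) = br x x + br x y + (br y x + br y y)"
    by (simp only: bilinear_ladd[OF br] bilinear_radd[OF br] add_ac)
  then have "br x y + br y x = 0" by (simp add: alt)
  then show ?thesis by (simp add: minus_unique)
qed

theorem proposition2p21:
  fixes A :: "('g::{t2_space, second_countable_topology}, 'e::euclidean_space) chart set"
    and mul :: "'g \<Rightarrow> 'g \<Rightarrow> 'g" and one :: 'g and ginv :: "'g \<Rightarrow> 'g"
    and br :: "'a::euclidean_space \<Rightarrow> 'a \<Rightarrow> 'a" and V1 V2 :: "'a set"
    and \<Phi> :: "'a \<Rightarrow> 'g vfield"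
    and e :: "'d::finite \<Rightarrow> 'a" and \<epsilon> :: "'h::finite \<Rightarrow> 'a"
  assumes "carnot_group_step_two A mul one ginv br V1 V2 \<Phi>"
    and "\<forall>x\<in>V1. \<forall>y\<in>V2. x \<bullet> y = 0"
    and "orthonormal_basis_of V1 e" and "orthonormal_basis_of V2 \<epsilon>"
  shows "CD A (sum_of_squares_op (\<lambda>i. \<Phi> (e i))) (GammaZ (\<lambda>m. \<Phi> (\<epsilon> m)))
           0 (carnot_rho2 (structure_const br e \<epsilon>)) (carnot_kappa (structure_const br e \<epsilon>))
           (ereal (real (dim V1)))"
proof -
  let ?\<gamma> = "structure_const br e \<epsilon>"
  interpret step_two_frame "C_infinity A" "\<lambda>i. \<Phi> (e i)" "\<lambda>m. \<Phi> (\<epsilon> m)" ?\<gamma>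
    by (rule carnot_frame[OF assms(1,3,4)])
  have lb: "lie_bracket br" and strat: "step_two_stratification br V1 V2"
    using assms(1) by (auto simp: carnot_group_step_two_def)
  have "?\<gamma> j i m = - ?\<gamma> i j m" for i j m
    unfolding structure_const_def by (subst lie_bracket_antisym[OF lb]) simp
  note curvature_dimension[OF _ _ this]
  moreover have "carnot_rho2 ?\<gamma> > 0"
    using lb strat assms(3,4)
    by (intro carnot_rho2_pos) (auto simp: lie_bracket_def step_two_stratification_def)
  \<comment> \<open>\<open>CD\<close> takes an extended real dimension; here it is finite and
    positive, so its reciprocal is the ordinary one.\<close>
  moreover have "real_of_ereal (1 / ereal (real CARD('d))) = 1 / real CARD('d)"
    by (simp add: one_ereal_def)
  ultimately show ?thesis
    by (simp add: CD_def orthonormal_basis_dim[OF assms(3)] carnot_kappa_nonneg)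
qed

end
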